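(* Let $d\ge 3$. For any integer $m\ge 1$, let $m=\sum_{i=0}^{k_m}c^{(m)}_i2^{di}$, where $0\le c^{(m)}_i\le 2^d-1$ for all $i\le k_m$ and $c^{(m)}_{k_m}>0$, be the representation of $m$ in base $2^d$. Then for every $n\ge 2$, $$L_n=\frac{(C_d+2)(n-1)n}{2}-C_d\sum_{m=1}^{n-1}\left[\sum_{i=0}^{k_m}c^{(m)}_i2^{(d-2)i}\right],\qquad\text{where } C_d:=\frac{2^{d-1}-2}{3\cdot 2^{d-2}}.$$
   Context: Dyadic cubes: for $k\ge 0$, $\mathcal{D}_k$ is the set of all cubes $\prod_{l=1}^d\left[\frac{i_l}{2^k},\frac{i_l+1}{2^k}\right)$ with $0\le i_1,\dots,i_d\le 2^k-1$. For distinct points $x,y\in[0,1)^d$ set $w(x,y)=2^{(d-2)(k-1)}$, where $k$ is the smallest integer such that $x$ and $y$ do not belong to the same cube of $\mathcal{D}_k$. For $\mathbf{x}=(x_1,\dots,x_n)$ let $H_n(\mathbf{x})=\sum_{i\ne j}w(x_i,x_j)$ (sum over ordered pairs). For $n\ge2$, the ground state energy is $L_n:=\min_{\mathbf{x}}H_n(\mathbf{x})$, the minimum being over $n$-tuples of distinct points of $[0,1)^d$, none of which lies on the boundary of a dyadic cube. *)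

theory Defs
  imports "HOL-Analysis.Analysis"
begin

definition dyadic_cubes :: "nat \<Rightarrow> (real ^ 'd::finite) set set" where
  "dyadic_cubes k =
     {{x. \<forall>l. real (i l) / 2 ^ k \<le> x $ l \<and> x $ l < (real (i l) + 1) / 2 ^ k} | i :: 'd \<Rightarrow> nat.
        \<forall>l. i l \<le> 2 ^ k - 1}"

definition half_open_unit_cube :: "(real ^ 'd::finite) set" where
  "half_open_unit_cube = {x. \<forall>l. 0 \<le> x $ l \<and> x $ l < 1}"

definition split_level :: "real ^ 'd::finite \<Rightarrow> real ^ 'd \<Rightarrow> nat" where
  "split_level x y = (LEAST k. \<not> (\<exists>Q\<in>dyadic_cubes k. x \<in> Q \<and> y \<in> Q))"

text \<open>
  Natural-number subtraction does not truncate below: two points of the half-open unit cube share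
  the single cube of level 0, so their split level is at least 1, and the dimension is always
  assumed to be at least 3.  The weight of a point with itself is a dummy value, never used.
\<close>

definition weight :: "real ^ 'd::finite \<Rightarrow> real ^ 'd \<Rightarrow> real" where
  "weight x y = 2 ^ ((CARD('d) - 2) * (split_level x y - 1))"

text \<open>An n-tuple is a function on the naturals of which only the values below n matter.\<close>

definition energy :: "nat \<Rightarrow> (nat \<Rightarrow> real ^ 'd::finite) \<Rightarrow> real" where
  "energy n x = (\<Sum>(i, j) \<in> {(i, j). i < n \<and> j < n \<and> i \<noteq> j}. weight (x i) (x j))"

definition configurations :: "nat \<Rightarrow> (nat \<Rightarrow> real ^ 'd::finite) set" where
  "configurations n =
     {x. inj_on x {..<n} \<and>
         (\<forall>i<n. x i \<in> half_open_unit_cube \<and> (\<forall>k. \<forall>Q\<in>dyadic_cubes k. x i \<notin> frontier Q))}"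

text \<open>
  The type argument carries the dimension.  LEAST on the reals denotes the minimum of the
  set of energies only if that minimum is attained, which is to be shown separately.
\<close>

definition ground_state_energy :: "'d::finite itself \<Rightarrow> nat \<Rightarrow> real" where
  "ground_state_energy _ n =
     (LEAST E. \<exists>x \<in> (configurations n :: (nat \<Rightarrow> real ^ 'd) set). E = energy n x)"

definition C_const :: "nat \<Rightarrow> real" where
  "C_const d = (2 ^ (d - 1) - 2) / (3 * 2 ^ (d - 2))"

end

theory Submission
  imports Defs
begin

text \<open>
  Let \<open>q = 2 ^ (d - 2)\<close>, so that every dyadic cube has \<open>2 ^ d = 4 * q\<close> children.  Two points of a
  cube of level \<open>k\<close> that lie in different children interact with weight exactly \<open>q ^ k\<close>.  Hence
  \<open>n\<close> points of such a cube, \<open>N b\<close> of them in the child \<open>b\<close>, have the energy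
  \<open>q ^ k * (n\<^sup>2 - (\<Sum>b. (N b)\<^sup>2))\<close> plus the energies inside the children (\<open>pair_energy_split\<close>), and
  passing to a child multiplies all weights by \<open>q\<close>.  The minimal energy \<open>F n\<close> should therefore be
  the minimum, over all ways to write \<open>n\<close> as a sum of \<open>4 * q\<close> numbers \<open>N b\<close>, of
  \<open>n\<^sup>2 + (\<Sum>b. q * F (N b) - (N b)\<^sup>2)\<close>.

  The closed formula, read as a definition of \<open>F\<close> (\<open>optimal_energy\<close>), solves this recursion.
  Its increments satisfy \<open>F (n + 1) - F n = (C + 2) * n - C * s n\<close>, where \<open>s\<close> reads the digits
  of \<open>n\<close> in base \<open>4 * q\<close> as if the base were \<open>q\<close>.  Since \<open>s (n + 1) \<le> s n + 1\<close>, consecutive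
  increments differ by at least \<open>2\<close>, so \<open>q * F k - k\<^sup>2\<close> is convex in \<open>k\<close>, and by
  the tangent line at \<open>n div (4 * q)\<close> the balanced distribution is optimal
  (\<open>optimal_energy_le_split\<close>).  The value of \<open>C\<close> is the one for which the balanced distribution
  gives equality (\<open>increment_step\<close>): the point added to \<open>n\<close> others goes to a child with
  \<open>n div (4 * q)\<close> points.

  The lower bound for every configuration follows by induction from small cubes to large ones,
  starting at a level that separates all points.  An optimal configuration is built by
  recursion on \<open>n\<close>: optimal configurations of balanced sizes are shrunk into the children.
\<close>

section \<open>The arithmetic recursion for the ground state energy\<close>

text \<open>
  The number with the digits of \<open>n\<close> in base \<open>B\<close>, evaluated at \<open>q\<close> in place of \<open>B\<close>.
\<close>

function rebase :: "nat \<Rightarrow> nat \<Rightarrow> nat \<Rightarrow> nat" where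
  "rebase B q n = (if n = 0 \<or> B < 2 then 0 else n mod B + q * rebase B q (n div B))"
  by pat_completeness auto
termination
  by (relation "Wellfounded.measure (\<lambda>(B, q, n). n)") (auto intro: div_less_dividend)

declare rebase.simps [simp del]

lemma rebase_0 [simp]: "rebase B q 0 = 0"
  by (simp add: rebase.simps)

lemma rebase_step:
  assumes "B \<ge> 2"
  shows "rebase B q n = n mod B + q * rebase B q (n div B)"
  using assms by (cases "n = 0") (simp_all add: rebase.simps[of B q n])

text \<open>
  By uniqueness of digits: \<open>mod\<close> and \<open>div\<close> by \<open>B\<close> peel off the constant term of any expansion with
  small coefficients.  This connects the recursion with expansions given as sums.
\<close>

lemma rebase_digits:
  assumes "B \<ge> 2" "\<And>i. i \<le> k \<Longrightarrow> c i < B"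
  shows "rebase B q (\<Sum>i=0..k. c i * B ^ i) = (\<Sum>i=0..k. c i * q ^ i)"
  using assms(2)
proof (induction k arbitrary: c)
  case 0
  then show ?case using assms(1) by (simp add: rebase_step[of B q "c 0"])
next
  case (Suc k)
  define N where "N = (\<Sum>i=0..k. c (Suc i) * B ^ i)"
  have shift: "(\<Sum>i=0..Suc k. c i * b ^ i) = c 0 + b * (\<Sum>i=0..k. c (Suc i) * b ^ i)" for b :: nat
    by (simp add: sum.atLeast0_atMost_Suc_shift sum_distrib_left mult_ac del: sum.cl_ivl_Suc)
  have "rebase B q (c 0 + B * N) = c 0 + q * rebase B q N"
    using assms(1) Suc.prems[of 0] by (subst rebase_step) auto
  moreover have "rebase B q N = (\<Sum>i=0..k. c (Suc i) * q ^ i)"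
    unfolding N_def by (rule Suc.IH) (simp add: Suc.prems)
  ultimately show ?case unfolding shift N_def by simp
qed

text \<open>
  Without a carry the value grows by exactly one.  A carry out of the last digit trades the digit
  \<open>B - 1\<close> for at most \<open>q\<close>, by induction on the remaining digits, and \<open>q \<le> B\<close>.
\<close>

lemma rebase_Suc_le:
  assumes "B \<ge> 2" "q \<le> B"
  shows "rebase B q (Suc n) \<le> Suc (rebase B q n)"
proof (induction n rule: less_induct)
  case (less n)
  show ?case
  proof (cases "Suc (n mod B) = B")
    case False
    then show ?thesis
      using assms by (simp add: rebase_step[of B q n] rebase_step[of B q "Suc n"] mod_Suc div_Suc)
  next
    case True
    then have n: "n > 0" using assms by (cases "n = 0") auto
    have "rebase B q (Suc (n div B)) \<le> Suc (rebase B q (n div B))"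
      by (rule less) (use n assms in auto)
    then have "q * rebase B q (Suc (n div B)) \<le> q * Suc (rebase B q (n div B))"
      by (rule mult_le_mono2)
    then show ?thesis using assms True
      by (simp add: rebase_step[of B q n] rebase_step[of B q "Suc n"] mod_Suc div_Suc)
  qed
qed

lemma four_times_power:
  assumes "d \<ge> 2"
  shows "4 * 2 ^ (d - 2) = (2 ^ d :: nat)"
proof -
  have "2 + (d - 2) = d" using assms by simp
  then have "(2::nat) ^ d = 2\<^sup>2 * 2 ^ (d - 2)" by (metis power_add)
  then show ?thesis by simp
qed

text \<open>
  The cost of adding a point to \<open>n\<close> optimally placed ones.  The factor \<open>(2 * q - 2) / (3 * q)\<close> is
  \<open>C_const d\<close> for \<open>q = 2 ^ (d - 2)\<close>.
\<close>

definition increment :: "nat \<Rightarrow> nat \<Rightarrow> real" where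
  "increment q n =
     ((2 * q - 2) / (3 * q) + 2) * real n - (2 * q - 2) / (3 * q) * rebase (4 * q) q n"

definition optimal_energy :: "nat \<Rightarrow> nat \<Rightarrow> real" where
  "optimal_energy q n = (\<Sum>m<n. increment q m)"

lemma optimal_energy_0 [simp]: "optimal_energy q 0 = 0"
  and optimal_energy_1 [simp]: "optimal_energy q (Suc 0) = 0"
  by (simp_all add: optimal_energy_def increment_def)

text \<open>
  The recursive meaning of the increment: the new point enters a child that contains
  \<open>m = n div (4 * q)\<close> points.  It forms \<open>n - m\<close> pairs with the points of the other children, each
  counted in both orders, and inside the child it costs an increment scaled by \<open>q\<close>.  The value
  of \<open>C\<close> enters through \<open>3 * q * C = 2 * q - 2\<close>, which is what equating the coefficients of \<open>m\<close>
  requires.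
\<close>

lemma increment_step:
  assumes "q \<ge> 1"
  shows "increment q n = 2 * real n - 2 * real (n div (4 * q)) + q * increment q (n div (4 * q))"
proof -
  define m c where "m = n div (4 * q)" and "c = n mod (4 * q)"
  define r where "r = real (rebase (4 * q) q m)"
  define C where "C = (2 * real q - 2) / (3 * real q)"
  have "n = 4 * q * m + c" by (simp add: m_def c_def)
  then have n: "real n = 4 * real q * real m + real c" by simp
  have "rebase (4 * q) q n = c + q * rebase (4 * q) q m"
    unfolding m_def c_def using assms by (intro rebase_step) simp
  then have s: "real (rebase (4 * q) q n) = real c + real q * r"
    by (simp add: r_def)
  have "C * (3 * real q) = 2 * real q - 2" using assms by (simp add: C_def)
  then have "real m * (C * (3 * real q)) = real m * (2 * real q - 2)" by (rule arg_cong)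
  then show ?thesis
    unfolding increment_def C_def[symmetric] s r_def[symmetric] m_def[symmetric] n
    by (simp add: algebra_simps)
qed

lemma increment_Suc_ge:
  assumes "q \<ge> 1"
  shows "increment q (Suc n) \<ge> increment q n + 2"
proof -
  define C where "C = (2 * real q - 2) / (3 * real q)"
  have "C \<ge> 0" using assms by (simp add: C_def)
  moreover have "real (rebase (4 * q) q (Suc n)) \<le> real (rebase (4 * q) q n) + 1"
    using rebase_Suc_le[of "4 * q" q n] assms by simp
  ultimately have "C * real (rebase (4 * q) q (Suc n)) \<le> C * (real (rebase (4 * q) q n) + 1)"
    by (rule mult_left_mono[rotated])
  then show ?thesis
    unfolding increment_def C_def[symmetric] by (simp add: algebra_simps)
qed

lemma discrete_tangent:
  fixes a :: "nat \<Rightarrow> real"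
  assumes "incseq a"
  shows "(\<Sum>j<k. a j) \<ge> (\<Sum>j<m. a j) + (real k - real m) * a m"
proof (cases "m \<le> k")
  case True
  then show ?thesis
  proof (induction k rule: dec_induct)
    case (step k)
    have "a m \<le> a k" using assms step by (simp add: incseq_def)
    then show ?case using step by (simp add: algebra_simps)
  qed simp
next
  case False
  then have "k \<le> m" by simp
  then show ?thesis
  proof (induction k rule: inc_induct)
    case (step k)
    have "a k \<le> a m" using assms step by (simp add: incseq_def)
    then show ?case using step by (simp add: algebra_simps)
  qed simp
qed

text \<open>
  In the splitting identity, the part of the energy that depends on the number \<open>k\<close> of points in
  one child.
\<close>

definition child_cost :: "nat \<Rightarrow> nat \<Rightarrow> real" where
  "child_cost q k = q * optimal_energy q k - (real k)\<^sup>2"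

definition child_increment :: "nat \<Rightarrow> nat \<Rightarrow> real" where
  "child_increment q k = q * increment q k - 2 * real k - 1"

lemma child_cost_Suc: "child_cost q (Suc k) = child_cost q k + child_increment q k"
  by (simp add: child_cost_def child_increment_def optimal_energy_def power2_eq_square algebra_simps)

lemma child_cost_sum: "child_cost q k = (\<Sum>j<k. child_increment q j)"
  by (induction k) (simp_all add: child_cost_Suc, simp add: child_cost_def)

text \<open>
  The increments of the energy grow by at least \<open>2\<close>, those of the square by exactly \<open>2\<close>; as
  \<open>q \<ge> 1\<close>, the difference \<open>q * optimal_energy q k - k\<^sup>2\<close> is convex.
\<close>

lemma child_cost_tangent:
  assumes "q \<ge> 1"
  shows "child_cost q k \<ge> child_cost q m + (real k - real m) * child_increment q m"
proof -
  have "child_increment q j \<le> child_increment q (Suc j)" for j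
  proof -
    have "real q * (increment q j + 2) \<le> real q * increment q (Suc j)"
      using increment_Suc_ge[OF assms] by (intro mult_left_mono) auto
    then show ?thesis using assms by (simp add: child_increment_def algebra_simps)
  qed
  then show ?thesis
    unfolding child_cost_sum by (intro discrete_tangent incseq_SucI)
qed

text \<open>
  The energy of the balanced distribution, in which \<open>n mod (4 * q)\<close> children receive one point more
  than the others.  Adding points one by one, the increments agree by \<open>increment_step\<close>; when
  the last digit overflows, all children have one more point and the tangent point moves on.
\<close>

lemma optimal_energy_balanced:
  assumes "q \<ge> 1"
  shows "optimal_energy q n = (real n)\<^sup>2 + 4 * q * child_cost q (n div (4 * q))
    + real (n mod (4 * q)) * child_increment q (n div (4 * q))"
proof (induction n)
  case 0
  show ?case by (simp add: child_cost_def)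
next
  case (Suc n)
  define m where "m = n div (4 * q)"
  have *: "optimal_energy q (Suc n) = (real (Suc n))\<^sup>2 + 4 * q * child_cost q m
    + (real (n mod (4 * q)) + 1) * child_increment q m"
    using Suc increment_step[OF assms, of n]
    by (simp add: m_def optimal_energy_def child_increment_def power2_eq_square algebra_simps)
  show ?case
  proof (cases "Suc (n mod (4 * q)) = 4 * q")
    case False
    with * show ?thesis by (simp add: mod_Suc div_Suc m_def add.commute)
  next
    case True
    have "real (n mod (4 * q)) + 1 = 4 * real q" using arg_cong[OF True, of real] by simp
    moreover have "Suc n div (4 * q) = Suc m" "Suc n mod (4 * q) = 0"
      using True by (simp_all add: mod_Suc div_Suc m_def)
    ultimately show ?thesis
      unfolding * by (simp add: child_cost_Suc distrib_left)
  qed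
qed

text \<open>
  Summing the tangent at \<open>n div (4 * q)\<close> over all children gives a bound that depends
  only on the total number of points, and it is the energy of the balanced distribution.
\<close>

lemma optimal_energy_le_split:
  fixes N :: "'i \<Rightarrow> nat"
  assumes "q \<ge> 1" "card I = 4 * q"
  shows "optimal_energy q (\<Sum>b\<in>I. N b) \<le>
    (real (\<Sum>b\<in>I. N b))\<^sup>2 - (\<Sum>b\<in>I. (real (N b))\<^sup>2) + q * (\<Sum>b\<in>I. optimal_energy q (N b))"
proof -
  define n m where "n = (\<Sum>b\<in>I. N b)" and "m = n div (4 * q)"
  have "real n = real (4 * q * m + n mod (4 * q))" by (simp add: m_def)
  then have n: "real n = 4 * real q * real m + real (n mod (4 * q))" by simp
  have "optimal_energy q n = (real n)\<^sup>2 +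
      (\<Sum>b\<in>I. child_cost q m + (real (N b) - real m) * child_increment q m)"
    using n assms(2)
    by (simp add: optimal_energy_balanced[OF assms(1)] sum.distrib flip: m_def sum_distrib_right)
       (simp add: sum_subtractf n_def[symmetric] flip: of_nat_sum)
  also have "\<dots> \<le> (real n)\<^sup>2 + (\<Sum>b\<in>I. child_cost q (N b))"
    by (intro add_left_mono sum_mono child_cost_tangent assms)
  finally show ?thesis
    by (simp add: n_def child_cost_def sum_subtractf sum_distrib_left)
qed

lemma optimal_energy_eq_balanced_split:
  assumes "q \<ge> 1" "card I = 4 * q"
  obtains N :: "'i \<Rightarrow> nat" where "(\<Sum>b\<in>I. N b) = n" "\<And>b. N b \<le> Suc (n div (4 * q))"
    "optimal_energy q n =
      (real n)\<^sup>2 - (\<Sum>b\<in>I. (real (N b))\<^sup>2) + q * (\<Sum>b\<in>I. optimal_energy q (N b))"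
proof -
  define m where "m = n div (4 * q)"
  have "finite I" using assms by (intro card_ge_0_finite) simp
  have "n mod (4 * q) \<le> card I" using assms by simp
  then obtain A where A: "A \<subseteq> I" "card A = n mod (4 * q)"
    by (meson obtain_subset_with_card_n)
  define N where "N b = m + (if b \<in> A then 1 else 0)" for b
  have AI: "A \<inter> I = A" "I \<inter> A = A" using A by auto
  have N: "(\<Sum>b\<in>I. N b) = n"
    using assms A \<open>finite I\<close> by (simp add: N_def sum.distrib AI m_def flip: sum.inter_restrict)
  have "(\<Sum>b\<in>I. child_cost q (N b)) =
      (\<Sum>b\<in>I. child_cost q m + (if b \<in> A then child_increment q m else 0))"
    by (intro sum.cong) (auto simp: N_def child_cost_Suc)
  also have "\<dots> = 4 * q * child_cost q m + real (n mod (4 * q)) * child_increment q m"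
    using assms A \<open>finite I\<close> by (simp add: sum.distrib AI flip: sum.inter_restrict)
  finally have "optimal_energy q n = (real n)\<^sup>2 + (\<Sum>b\<in>I. child_cost q (N b))"
    by (simp add: optimal_energy_balanced[OF assms(1)] m_def)
  then show thesis
    by (intro that[of N] N) (auto simp: N_def m_def child_cost_def sum_subtractf sum_distrib_left)
qed

section \<open>Addresses of points in the dyadic hierarchy\<close>

text \<open>
  The integer coordinates of the cube of level \<open>k\<close> containing \<open>x\<close>.  They replace the cubes
  themselves: lying in a common cube becomes an equation between functions.
\<close>

definition address :: "nat \<Rightarrow> real ^ 'd::finite \<Rightarrow> 'd \<Rightarrow> int" where
  "address k x l = \<lfloor>2 ^ k * x $ l\<rfloor>"

lemma address_0:
  assumes "x \<in> half_open_unit_cube"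
  shows "address 0 x = (\<lambda>l. 0)"
  using assms by (auto simp: address_def half_open_unit_cube_def fun_eq_iff floor_eq_iff)

lemma address_Suc_div: "address (Suc k) x l div 2 = address k x l"
proof -
  have "\<lfloor>(2 ^ Suc k * x $ l) / real_of_int 2\<rfloor> = \<lfloor>2 ^ Suc k * x $ l\<rfloor> div 2"
    by (rule floor_divide_real_eq_div) simp
  then show ?thesis by (simp add: address_def)
qed

text \<open>
  Dyadic cubes are nested.
\<close>

lemma address_eq_mono:
  assumes "j \<le> k" "address k x = address k y"
  shows "address j x = address j y"
  using assms
proof (induction j rule: inc_induct)
  case (step j)
  then show ?case by (metis address_Suc_div ext)
qed

lemma dyadic_cube_iff_address:
  assumes "x \<in> half_open_unit_cube"
  shows "(\<exists>Q\<in>dyadic_cubes k. x \<in> Q \<and> y \<in> Q) \<longleftrightarrow> address k x = address k y"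
proof
  assume "\<exists>Q\<in>dyadic_cubes k. x \<in> Q \<and> y \<in> Q"
  then obtain i :: "'a \<Rightarrow> nat" where
    "\<forall>l. real (i l) / 2 ^ k \<le> x $ l \<and> x $ l < (real (i l) + 1) / 2 ^ k"
    "\<forall>l. real (i l) / 2 ^ k \<le> y $ l \<and> y $ l < (real (i l) + 1) / 2 ^ k"
    by (auto simp: dyadic_cubes_def)
  then have "address k x l = int (i l)" "address k y l = int (i l)" for l
    by (auto simp: address_def floor_eq_iff field_simps)
  then show "address k x = address k y" by auto
next
  assume eq: "address k x = address k y"
  have x: "0 \<le> x $ l" "x $ l < 1" for l
    using assms by (auto simp: half_open_unit_cube_def)
  define i where "i l = nat (address k x l)" for l
  have i: "real (i l) = of_int (address k x l)" for l
    using x by (simp add: i_def address_def)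
  have "i l \<le> 2 ^ k - 1" for l
  proof -
    have "2 ^ k * x $ l < 2 ^ k" using x by simp
    then have "address k x l < 2 ^ k" by (simp add: address_def floor_less_iff)
    then have "i l < 2 ^ k" by (simp add: i_def nat_less_iff)
    then show ?thesis by simp
  qed
  moreover have "real (i l) / 2 ^ k \<le> z $ l \<and> z $ l < (real (i l) + 1) / 2 ^ k"
    if "address k z = address k x" for z l
  proof -
    have "real (i l) = of_int \<lfloor>2 ^ k * z $ l\<rfloor>"
      by (simp add: i that flip: address_def)
    then show ?thesis
      by (simp add: pos_divide_le_eq pos_less_divide_eq mult.commute[of _ "2 ^ k"])
  qed
  ultimately show "\<exists>Q\<in>dyadic_cubes k. x \<in> Q \<and> y \<in> Q"
    using eq unfolding dyadic_cubes_def by (intro bexI[of _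
      "{x. \<forall>l. real (i l) / 2 ^ k \<le> x $ l \<and> x $ l < (real (i l) + 1) / 2 ^ k}"]) auto
qed

lemma split_level_address:
  assumes "x \<in> half_open_unit_cube"
  shows "split_level x y = (LEAST k. address k x \<noteq> address k y)"
  unfolding split_level_def dyadic_cube_iff_address[OF assms] ..

text \<open>
  Two points of a common cube of level \<open>k\<close> are less than \<open>1 / 2 ^ k\<close> apart in every coordinate.
\<close>

lemma eventually_address_neq:
  assumes "x \<noteq> y"
  shows "eventually (\<lambda>k. address k x \<noteq> address k y) sequentially"
proof -
  obtain l where l: "x $ l \<noteq> y $ l" using assms by (auto simp: vec_eq_iff)
  then obtain K where K: "(1/2) ^ K < \<bar>x $ l - y $ l\<bar>"
    using real_arch_pow_inv[of "\<bar>x $ l - y $ l\<bar>" "1/2"] by auto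
  have "address K x \<noteq> address K y"
  proof
    assume "address K x = address K y"
    then have "\<lfloor>2 ^ K * x $ l\<rfloor> = \<lfloor>2 ^ K * y $ l\<rfloor>" by (metis address_def)
    then have "\<bar>2 ^ K * x $ l - 2 ^ K * y $ l\<bar> < 1" by linarith
    then have "2 ^ K * \<bar>x $ l - y $ l\<bar> < 1"
      by (simp add: abs_mult flip: right_diff_distrib)
    with K show False by (simp add: field_simps)
  qed
  then show ?thesis
    unfolding eventually_sequentially using address_eq_mono by blast
qed

text \<open>
  The children of a cube are labelled by the set of directions in which they are the upper half;
  the labels then form a finite type with \<open>2 ^ d\<close> elements.
\<close>

definition child_index :: "nat \<Rightarrow> real ^ 'd::finite \<Rightarrow> 'd set" where
  "child_index k x = {l. odd (address (Suc k) x l)}"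

lemma address_Suc_eq_iff:
  "address (Suc k) x = address (Suc k) y \<longleftrightarrow>
     address k x = address k y \<and> child_index k x = child_index k y"
proof
  assume "address (Suc k) x = address (Suc k) y"
  then show "address k x = address k y \<and> child_index k x = child_index k y"
    using address_eq_mono[of k "Suc k" x y] by (simp add: child_index_def)
next
  assume "address k x = address k y \<and> child_index k x = child_index k y"
  then have "address (Suc k) x l div 2 = address (Suc k) y l div 2"
    "odd (address (Suc k) x l) = odd (address (Suc k) y l)" for l
    by (auto simp: child_index_def address_Suc_div)
  then show "address (Suc k) x = address (Suc k) y"
    by (intro ext) (metis div_mult_mod_eq parity_cases)
qed

lemma weight_split:
  fixes x y :: "real ^ 'd::finite"
  assumes "x \<in> half_open_unit_cube" "address k x = address k y" "child_index k x \<noteq> child_index k y"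
  shows "weight x y = (2 ^ (CARD('d) - 2)) ^ k"
proof -
  have "address (Suc k) x \<noteq> address (Suc k) y"
    using assms by (simp add: address_Suc_eq_iff)
  moreover have "\<not> j < Suc k" if "address j x \<noteq> address j y" for j
    using that assms(2) address_eq_mono[of j k x y] by auto
  ultimately have "split_level x y = Suc k"
    unfolding split_level_address[OF assms(1)]
    by (intro Least_equality) (auto simp: not_less)
  then show ?thesis by (simp add: weight_def power_mult)
qed

section \<open>Splitting the energy over the children of a cube\<close>

text \<open>
  The energy depends only on the set of points.  The diagonal must be excluded explicitly since
  \<open>weight x x\<close> is not zero.
\<close>

definition pair_energy :: "(real ^ 'd::finite) set \<Rightarrow> real" where
  "pair_energy S = (\<Sum>x\<in>S. \<Sum>y\<in>S. if x = y then 0 else weight x y)"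

lemma energy_eq_pair_energy:
  assumes "inj_on x {..<n}"
  shows "energy n x = pair_energy (x ` {..<n})"
proof -
  have "pair_energy (x ` {..<n}) = (\<Sum>i<n. \<Sum>j<n. if x i = x j then 0 else weight (x i) (x j))"
    by (simp add: pair_energy_def sum.reindex[OF assms])
  also have "\<dots> = (\<Sum>i<n. \<Sum>j<n. if i \<noteq> j then weight (x i) (x j) else 0)"
    using assms by (intro sum.cong) (auto simp: inj_on_def)
  also have "\<dots> = (\<Sum>p\<in>{..<n} \<times> {..<n}. if fst p \<noteq> snd p then weight (x (fst p)) (x (snd p)) else 0)"
    by (simp add: sum.cartesian_product case_prod_beta)
  also have "\<dots> = (\<Sum>p\<in>{p \<in> {..<n} \<times> {..<n}. fst p \<noteq> snd p}. weight (x (fst p)) (x (snd p)))"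
    by (intro sum.inter_filter[symmetric]) simp
  also have "{p \<in> {..<n} \<times> {..<n}. fst p \<noteq> snd p} = {(i, j). i < n \<and> j < n \<and> i \<noteq> j}"
    by auto
  finally show ?thesis by (simp add: energy_def case_prod_beta)
qed

lemma sum_pairs_same_class:
  fixes f :: "'a \<Rightarrow> 'a \<Rightarrow> real" and g :: "'a \<Rightarrow> 'b::finite"
  assumes "finite S"
  shows "(\<Sum>x\<in>S. \<Sum>y\<in>S. if g x = g y then f x y else 0) =
    (\<Sum>b\<in>UNIV. \<Sum>x\<in>{x\<in>S. g x = b}. \<Sum>y\<in>{y\<in>S. g y = b}. f x y)"
proof -
  have inner: "(\<Sum>y\<in>{y\<in>S. g y = b}. f x y) = (\<Sum>y\<in>S. if g x = g y then f x y else 0)"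
    if "g x = b" for x b
    unfolding sum.inter_filter[OF assms] using that by (intro sum.cong) auto
  have "(\<Sum>b\<in>UNIV. \<Sum>x\<in>{x\<in>S. g x = b}. \<Sum>y\<in>{y\<in>S. g y = b}. f x y) =
      (\<Sum>b\<in>UNIV. \<Sum>x\<in>{x\<in>S. g x = b}. \<Sum>y\<in>S. if g x = g y then f x y else 0)"
    by (rule sum.cong[OF refl], rule sum.cong[OF refl], rule inner) simp
  also have "\<dots> = (\<Sum>x\<in>S. \<Sum>y\<in>S. if g x = g y then f x y else 0)"
    using assms by (intro sum.group) auto
  finally show ?thesis ..
qed

text \<open>
  Ordered pairs of points with different labels, of which there are
  \<open>(card S)\<^sup>2 - (\<Sum>b. (card (S b))\<^sup>2)\<close> when \<open>S b\<close> are the points labelled \<open>b\<close>, separate exactly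
  at level \<open>k + 1\<close>.
\<close>

lemma pair_energy_split:
  fixes S :: "(real ^ 'd::finite) set"
  assumes "finite S" "S \<subseteq> half_open_unit_cube"
    and "\<And>x y. x \<in> S \<Longrightarrow> y \<in> S \<Longrightarrow> address k x = address k y"
  shows "pair_energy S =
    (2 ^ (CARD('d) - 2)) ^ k *
      ((real (card S))\<^sup>2 - (\<Sum>b\<in>UNIV. (real (card {x\<in>S. child_index k x = b}))\<^sup>2))
    + (\<Sum>b\<in>UNIV. pair_energy {x\<in>S. child_index k x = b})"
proof -
  let ?w = "\<lambda>x y. if x = y then 0 else weight x (y :: real ^ 'd)"
  let ?g = "child_index k :: real ^ 'd \<Rightarrow> 'd set"
  define Q :: real where "Q = (2 ^ (CARD('d) - 2)) ^ k"
  have "pair_energy S = (\<Sum>x\<in>S. \<Sum>y\<in>S. Q * (1 - (if ?g x = ?g y then 1 else 0))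
      + (if ?g x = ?g y then ?w x y else 0))"
    unfolding pair_energy_def
  proof (intro sum.cong refl)
    fix x y assume xy: "x \<in> S" "y \<in> S"
    show "?w x y = Q * (1 - (if ?g x = ?g y then 1 else 0)) + (if ?g x = ?g y then ?w x y else 0)"
    proof (cases "?g x = ?g y")
      case False
      then have "weight x y = Q"
        unfolding Q_def using xy assms(2) by (intro weight_split assms(3)) auto
      with False show ?thesis by auto
    qed simp
  qed
  also have "\<dots> = Q * ((\<Sum>x\<in>S. \<Sum>y\<in>S. 1) - (\<Sum>x\<in>S. \<Sum>y\<in>S. if ?g x = ?g y then 1 else 0))
      + (\<Sum>x\<in>S. \<Sum>y\<in>S. if ?g x = ?g y then ?w x y else 0)"
    by (simp only: sum.distrib sum_distrib_left sum_subtractf right_diff_distrib)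
  also have "\<dots> = Q * ((real (card S))\<^sup>2 - (\<Sum>b\<in>UNIV. (real (card {x\<in>S. ?g x = b}))\<^sup>2))
      + (\<Sum>b\<in>UNIV. pair_energy {x\<in>S. ?g x = b})"
    using sum_pairs_same_class[OF assms(1), of ?g "\<lambda>x y. 1"]
      sum_pairs_same_class[OF assms(1), of ?g ?w]
    by (simp only: pair_energy_def) (simp add: power2_eq_square)
  finally show ?thesis unfolding Q_def .
qed

lemma card_eq_sum_child_index:
  fixes S :: "(real ^ 'd::finite) set"
  assumes "finite S"
  shows "card S = (\<Sum>b\<in>UNIV. card {x\<in>S. child_index k x = b})"
  using sum.group[OF assms, of UNIV "child_index k" "\<lambda>_. 1::nat"] by simp

lemma card_children:
  assumes "CARD('d::finite) \<ge> 2"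
  shows "card (UNIV :: 'd set set) = 4 * 2 ^ (CARD('d) - 2)"
  using four_times_power[OF assms] by (simp add: card_UNIV_set)

section \<open>The lower bound\<close>

text \<open>
  Induction from the level \<open>K\<close>, at which every cube contains at most one point, up to larger
  cubes.
\<close>

lemma pair_energy_ge_in_cube:
  fixes S :: "(real ^ 'd::finite) set"
  assumes d: "CARD('d) \<ge> 2" and "k \<le> K"
    and "finite S" "S \<subseteq> half_open_unit_cube"
    and "\<And>x y. x \<in> S \<Longrightarrow> y \<in> S \<Longrightarrow> address k x = address k y"
    and "inj_on (address K) S"
  shows "pair_energy S \<ge> (2 ^ (CARD('d) - 2)) ^ k * optimal_energy (2 ^ (CARD('d) - 2)) (card S)"
  using assms(2-)
proof (induction k arbitrary: S rule: inc_induct)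
  case base
  have "S = {} \<or> (\<exists>x. S = {x})"
    using base(3,4) unfolding inj_on_def by blast
  then show ?case by (auto simp: pair_energy_def)
next
  case (step k)
  define q where "q = (2::nat) ^ (CARD('d) - 2)"
  define T where "T b = {x\<in>S. child_index k x = b}" for b
  have q: "(2::real) ^ (CARD('d) - 2) = real q" "2 ^ (CARD('d) - 2) = q"
    by (simp_all add: q_def)
  have IH: "real q ^ Suc k * optimal_energy q (card (T b)) \<le> pair_energy (T b)" for b
    unfolding q(1)[symmetric] unfolding q(2)[symmetric]
  proof (rule step.IH)
    \<comment> \<open>Points with the same label share the next smaller cube.\<close>
    show "address (Suc k) x = address (Suc k) y" if "x \<in> T b" "y \<in> T b" for x y
      using that step.prems(3)[of x y] by (simp add: T_def address_Suc_eq_iff)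
    show "inj_on (address K) (T b)"
      using step.prems(4) by (rule inj_on_subset) (auto simp: T_def)
  qed (use step.prems(1,2) in \<open>auto simp: T_def\<close>)
  have "optimal_energy q (card S) \<le> (real (card S))\<^sup>2 - (\<Sum>b\<in>UNIV. (real (card (T b)))\<^sup>2)
      + q * (\<Sum>b\<in>UNIV. optimal_energy q (card (T b)))"
    using optimal_energy_le_split[of q UNIV "\<lambda>b. card (T b)"] card_children[OF d]
      card_eq_sum_child_index[OF step.prems(1), of k]
    by (simp add: q_def T_def)
  then have "real q ^ k * optimal_energy q (card S) \<le>
      real q ^ k * ((real (card S))\<^sup>2 - (\<Sum>b\<in>UNIV. (real (card (T b)))\<^sup>2)
      + q * (\<Sum>b\<in>UNIV. optimal_energy q (card (T b))))"
    by (intro mult_left_mono) auto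
  also have "\<dots> = real q ^ k * ((real (card S))\<^sup>2 - (\<Sum>b\<in>UNIV. (real (card (T b)))\<^sup>2))
      + (\<Sum>b\<in>UNIV. real q ^ Suc k * optimal_energy q (card (T b)))"
    by (simp add: algebra_simps flip: sum_distrib_left)
  also have "\<dots> \<le> real q ^ k * ((real (card S))\<^sup>2 - (\<Sum>b\<in>UNIV. (real (card (T b)))\<^sup>2))
      + (\<Sum>b\<in>UNIV. pair_energy (T b))"
    by (intro add_left_mono sum_mono IH)
  also have "\<dots> = pair_energy S"
    using pair_energy_split[OF step.prems(1-3)] by (simp add: T_def q)
  finally show ?case unfolding q .
qed

lemma pair_energy_ge:
  fixes S :: "(real ^ 'd::finite) set"
  assumes "CARD('d) \<ge> 2" "finite S" "S \<subseteq> half_open_unit_cube"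
  shows "pair_energy S \<ge> optimal_energy (2 ^ (CARD('d) - 2)) (card S)"
proof -
  have "eventually (\<lambda>k. \<forall>x\<in>S. \<forall>y\<in>S. x \<noteq> y \<longrightarrow> address k x \<noteq> address k y) sequentially"
  proof (intro eventually_ball_finite[OF assms(2)] ballI)
    show "eventually (\<lambda>k. x \<noteq> y \<longrightarrow> address k x \<noteq> address k y) sequentially" for x y :: "real ^ 'd"
      by (cases "x = y") (simp_all add: eventually_address_neq)
  qed
  then obtain K where inj: "inj_on (address K) S"
    unfolding eventually_sequentially inj_on_def by blast
  have addr: "address 0 x = address 0 y" if "x \<in> S" "y \<in> S" for x y
    using that by (simp add: address_0 subsetD[OF assms(3)])
  have "(2 ^ (CARD('d) - 2)) ^ 0 * optimal_energy (2 ^ (CARD('d) - 2)) (card S) \<le> pair_energy S"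
    by (rule pair_energy_ge_in_cube[OF assms(1) le0 assms(2,3) addr inj])
  then show ?thesis by simp
qed

section \<open>Optimal configurations\<close>

text \<open>
  The similarity of the unit cube onto its child with label \<open>b\<close>.
\<close>

definition into_child :: "'d set \<Rightarrow> real ^ 'd::finite \<Rightarrow> real ^ 'd" where
  "into_child b x = (\<chi> l. (x $ l + of_bool (l \<in> b)) / 2)"

lemma into_child_unit_cube:
  "x \<in> half_open_unit_cube \<Longrightarrow> into_child b x \<in> half_open_unit_cube"
  by (auto simp: half_open_unit_cube_def into_child_def add_pos_nonneg intro: add_less_le_mono)
     (smt (verit) of_bool_less_eq_one)

lemma inj_into_child: "inj (into_child b)"
  by (auto simp: inj_def into_child_def vec_eq_iff)

lemma address_Suc_into_child:
  "address (Suc k) (into_child b x) l = address k x l + 2 ^ k * of_bool (l \<in> b)"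
proof -
  have "2 ^ Suc k * into_child b x $ l = 2 ^ k * x $ l + of_int (2 ^ k * of_bool (l \<in> b))"
    by (simp add: into_child_def algebra_simps)
  then show ?thesis unfolding address_def by (metis floor_add_int)
qed

lemma child_index_into_child:
  assumes "x \<in> half_open_unit_cube"
  shows "child_index 0 (into_child b x) = b"
  by (auto simp: child_index_def address_Suc_into_child address_0[OF assms])

text \<open>
  The similarity shifts addresses by one level, hence the split level increases by one.
\<close>

lemma weight_into_child:
  fixes x y :: "real ^ 'd::finite"
  assumes "x \<in> half_open_unit_cube" "y \<in> half_open_unit_cube" "x \<noteq> y"
  shows "weight (into_child b x) (into_child b y) = 2 ^ (CARD('d) - 2) * weight x y"
proof -
  have zero: "address 0 u = address 0 v"
    if "u \<in> half_open_unit_cube" "v \<in> half_open_unit_cube" for u v :: "real ^ 'd"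
    using that by (simp add: address_0)
  have "eventually (\<lambda>k. address k x \<noteq> address k y) sequentially"
    using assms(3) by (rule eventually_address_neq)
  then obtain K where K: "address K x \<noteq> address K y"
    by (auto simp: eventually_sequentially)
  have Suc: "address (Suc k) (into_child b x) \<noteq> address (Suc k) (into_child b y) \<longleftrightarrow>
      address k x \<noteq> address k y" for k
    by (simp add: fun_eq_iff address_Suc_into_child)
  have "split_level (into_child b x) (into_child b y) = Suc (split_level x y)"
    unfolding split_level_address[OF assms(1)]
      split_level_address[OF into_child_unit_cube[OF assms(1)]] Suc[symmetric]
  proof (rule Least_Suc)
    show "address (Suc K) (into_child b x) \<noteq> address (Suc K) (into_child b y)"
      using K Suc by blast
    show "\<not> address 0 (into_child b x) \<noteq> address 0 (into_child b y)"
      using zero[OF assms(1,2)[THEN into_child_unit_cube]] by blast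
  qed
  moreover have "split_level x y \<noteq> 0"
    unfolding split_level_address[OF assms(1)]
    using LeastI[of "\<lambda>k. address k x \<noteq> address k y", OF K] zero[OF assms(1,2)] by auto
  then obtain s where "split_level x y = Suc s"
    using not0_implies_Suc by blast
  ultimately show ?thesis by (simp add: weight_def power_add)
qed

lemma pair_energy_into_child:
  fixes S :: "(real ^ 'd::finite) set"
  assumes "S \<subseteq> half_open_unit_cube"
  shows "pair_energy (into_child b ` S) = 2 ^ (CARD('d) - 2) * pair_energy S"
proof -
  have inj: "inj_on (into_child b) S" using inj_into_child by (rule inj_on_subset) simp
  show ?thesis
    unfolding pair_energy_def sum.reindex[OF inj] sum_distrib_left o_def
    by (intro sum.cong)
       (auto simp: weight_into_child subsetD[OF assms] inj_eq[OF inj_into_child])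
qed

text \<open>
  A condition on coordinates that keeps a point away from the boundaries of all dyadic cubes and that
  is easily seen to survive the maps \<open>into_child b\<close>.
\<close>

definition off_grid :: "real ^ 'd::finite \<Rightarrow> bool" where
  "off_grid x \<longleftrightarrow> (\<forall>k l. 2 ^ k * x $ l \<notin> \<int>)"

lemma off_grid_into_child:
  assumes "off_grid x"
  shows "off_grid (into_child b x)"
  unfolding off_grid_def
proof (intro allI notI)
  fix k l
  have "2 * z - 2 ^ k * of_bool (l \<in> b) \<in> \<int>" if "z \<in> \<int>" for z :: real
    using that by (intro Ints_diff Ints_mult Ints_power) auto
  moreover assume "2 ^ k * into_child b x $ l \<in> \<int>"
  ultimately have "2 * (2 ^ k * into_child b x $ l) - 2 ^ k * of_bool (l \<in> b) \<in> \<int>"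
    by blast
  also have "2 * (2 ^ k * into_child b x $ l) - 2 ^ k * of_bool (l \<in> b) = 2 ^ k * x $ l"
    by (simp add: into_child_def field_simps)
  finally show False
    using assms by (simp add: off_grid_def)
qed

lemma off_grid_one_third: "off_grid (\<chi> l. 1 / 3)"
  unfolding off_grid_def
proof (intro allI notI)
  fix k :: nat and l :: 'a
  assume "2 ^ k * (\<chi> l :: 'a. (1 / 3 :: real)) $ l \<in> \<int>"
  then obtain z where "2 ^ k / 3 = real_of_int z" by (auto elim: Ints_cases)
  then have "real_of_int (2 ^ k) = real_of_int (3 * z)" by simp
  then have "(2::int) ^ k = 3 * z" by (simp only: of_int_eq_iff)
  then have "(3::int) dvd 2 ^ k" by simp
  moreover have "coprime (3::int) (2 ^ k)" by simp
  ultimately show False using coprime_common_divisor[of "3::int" "2 ^ k" 3] by simp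
qed

lemma off_grid_not_frontier:
  assumes "off_grid x" "Q \<in> dyadic_cubes k"
  shows "x \<notin> frontier Q"
proof
  assume x: "x \<in> frontier Q"
  obtain i :: "'a \<Rightarrow> nat" where
    Q: "Q = {x. \<forall>l. real (i l) / 2 ^ k \<le> x $ l \<and> x $ l < (real (i l) + 1) / 2 ^ k}"
    using assms(2) by (auto simp: dyadic_cubes_def)
  define a b :: "real ^ 'a"
    where "a = (\<chi> l. real (i l) / 2 ^ k)" and "b = (\<chi> l. (real (i l) + 1) / 2 ^ k)"
  have "Q \<subseteq> cbox a b" by (auto simp: Q a_def b_def mem_box_cart less_imp_le)
  then have "closure Q \<subseteq> cbox a b" by (rule closure_minimal) (rule closed_cbox)
  then have "a $ l \<le> x $ l \<and> x $ l \<le> b $ l" for l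
    using x by (auto simp: frontier_def mem_box_cart)
  moreover have "a $ l \<noteq> x $ l \<and> b $ l \<noteq> x $ l" for l
  proof -
    have "2 ^ k * a $ l \<in> \<int>" "2 ^ k * b $ l \<in> \<int>" by (simp_all add: a_def b_def)
    then show ?thesis using assms(1) by (metis off_grid_def)
  qed
  ultimately have "x \<in> box a b" by (simp add: mem_box_cart order_less_le) metis
  moreover have "box a b \<subseteq> interior Q"
    by (rule interior_maximal) (auto simp: Q a_def b_def mem_box_cart less_imp_le)
  ultimately show False using x by (auto simp: frontier_def)
qed

text \<open>
  For \<open>n \<ge> 2\<close> every child of a balanced distribution gets fewer than \<open>n\<close> points, so the images
  of optimal configurations of these sizes can be combined; the splitting identity at level \<open>0\<close> and the
  equality case of the arithmetic recursion give the energy.  A single point has to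
  avoid the dyadic grid, for which all coordinates \<open>1 / 3\<close> serve.
\<close>

lemma optimal_points_exist:
  assumes d: "CARD('d::finite) \<ge> 2"
  shows "\<exists>S :: (real ^ 'd) set. finite S \<and> card S = n \<and> S \<subseteq> half_open_unit_cube \<and>
    (\<forall>x\<in>S. off_grid x) \<and> pair_energy S = optimal_energy (2 ^ (CARD('d) - 2)) n"
proof (induction n rule: less_induct)
  case (less n)
  define q where "q = (2::nat) ^ (CARD('d) - 2)"
  have q: "(2::real) ^ (CARD('d) - 2) = real q" "2 ^ (CARD('d) - 2) = q" "q \<ge> 1"
    by (simp_all add: q_def)
  consider "n = 0" | "n = 1" | "n \<ge> 2" by linarith
  then show ?case
  proof cases
    case 1
    then show ?thesis by (intro exI[of _ "{}"]) (simp add: pair_energy_def)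
  next
    case 2
    then show ?thesis
      by (intro exI[of _ "{\<chi> l. 1 / 3}"])
         (simp add: pair_energy_def off_grid_one_third half_open_unit_cube_def)
  next
    case 3
    have children: "card (UNIV :: 'd set set) = 4 * q"
      using card_children[OF d] by (simp add: q_def)
    obtain N :: "'d set \<Rightarrow> nat" where N: "(\<Sum>b\<in>UNIV. N b) = n" "\<And>b. N b \<le> Suc (n div (4 * q))"
      "optimal_energy q n =
        (real n)\<^sup>2 - (\<Sum>b\<in>UNIV. (real (N b))\<^sup>2) + q * (\<Sum>b\<in>UNIV. optimal_energy q (N b))"
      by (rule optimal_energy_eq_balanced_split[OF q(3) children, of n]) blast
    have "N b < n" for b
    proof -
      have "n div (4 * q) \<le> n div 4" using q by (intro div_le_mono2) auto
      then show ?thesis using N(2)[of b] 3 by linarith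
    qed
    then have "\<forall>b. \<exists>S :: (real ^ 'd) set. finite S \<and> card S = N b \<and> S \<subseteq> half_open_unit_cube \<and>
        (\<forall>x\<in>S. off_grid x) \<and> pair_energy S = optimal_energy q (N b)"
      unfolding q_def by (intro allI less.IH)
    from choice[OF this] obtain T :: "'d set \<Rightarrow> (real ^ 'd) set" where
      T: "\<And>b. finite (T b)" "\<And>b. card (T b) = N b" "\<And>b. T b \<subseteq> half_open_unit_cube"
        "\<And>b x. x \<in> T b \<Longrightarrow> off_grid x" "\<And>b. pair_energy (T b) = optimal_energy q (N b)"
      by blast
    define S where "S = (\<Union>b. into_child b ` T b)"
    have S: "finite S" "S \<subseteq> half_open_unit_cube" "\<forall>x\<in>S. off_grid x"
      using T(1) by (auto simp: S_def into_child_unit_cube subsetD[OF T(3)]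
        intro: off_grid_into_child T(4))
    have child: "{x\<in>S. child_index 0 x = b} = into_child b ` T b" for b
      by (auto simp: S_def child_index_into_child subsetD[OF T(3)])
    have card_child: "card (into_child b ` T b) = N b" for b
      by (simp add: card_image inj_on_subset[OF inj_into_child] T(2))
    have card: "card S = n"
      using card_eq_sum_child_index[OF S(1), of 0] by (simp add: child card_child N)
    have addr: "address 0 x = address 0 y" if "x \<in> S" "y \<in> S" for x y
      using that by (simp add: address_0 subsetD[OF S(2)])
    have "pair_energy S = (real n)\<^sup>2 - (\<Sum>b\<in>UNIV. (real (N b))\<^sup>2)
        + (\<Sum>b\<in>UNIV. pair_energy (into_child b ` T b))"
      using pair_energy_split[OF S(1,2) addr] by (simp add: child card_child card)
    also have "\<dots> = optimal_energy q n"
      by (simp add: N(3) pair_energy_into_child[OF T(3)] T(5) q sum_distrib_left)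
    finally show ?thesis using S card unfolding q(2) by blast
  qed
qed

section \<open>The ground state energy\<close>

lemma optimal_energy_closed_form:
  fixes c :: "nat \<Rightarrow> nat \<Rightarrow> nat" and k :: "nat \<Rightarrow> nat"
  assumes "d \<ge> 2" "n \<ge> 1"
    and "\<And>m. m \<ge> 1 \<Longrightarrow> m = (\<Sum>i=0..k m. c m i * 2 ^ (d * i))"
    and "\<And>m i. m \<ge> 1 \<Longrightarrow> i \<le> k m \<Longrightarrow> c m i \<le> 2 ^ d - 1"
  shows "optimal_energy (2 ^ (d - 2)) n = (C_const d + 2) * (real n - 1) * real n / 2
      - C_const d * (\<Sum>m=1..n - 1. \<Sum>i=0..k m. real (c m i) * 2 ^ ((d - 2) * i))"
proof -
  define q where "q = (2::nat) ^ (d - 2)"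
  have B: "4 * q = 2 ^ d"
    using four_times_power[OF assms(1)] by (simp add: q_def)
  have C: "C_const d = (2 * real q - 2) / (3 * real q)"
  proof -
    have "d - 1 = Suc (d - 2)" using assms(1) by simp
    then show ?thesis by (simp add: C_const_def q_def)
  qed
  have digits: "real (rebase (4 * q) q m) = (\<Sum>i=0..k m. real (c m i) * 2 ^ ((d - 2) * i))"
    if "m \<ge> 1" for m
  proof -
    have "rebase (4 * q) q (\<Sum>i=0..k m. c m i * (4 * q) ^ i) = (\<Sum>i=0..k m. c m i * q ^ i)"
    proof (rule rebase_digits)
      show "4 * q \<ge> 2" by (simp add: q_def)
      show "c m i < 4 * q" if "i \<le> k m" for i
        using assms(4)[OF \<open>m \<ge> 1\<close> that] zero_less_power[of "2::nat" d] unfolding B by linarith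
    qed
    also have "(\<Sum>i=0..k m. c m i * (4 * q) ^ i) = m"
      unfolding B power_mult[symmetric] using assms(3)[OF that] by (rule sym)
    finally show ?thesis by (simp add: q_def power_mult)
  qed
  have "optimal_energy q n =
      (C_const d + 2) * (\<Sum>m<n. real m) - C_const d * (\<Sum>m<n. real (rebase (4 * q) q m))"
    by (simp add: optimal_energy_def increment_def C sum_subtractf sum_distrib_left)
  also have "(\<Sum>m<n. real m) = (real n - 1) * real n / 2"
    by (induction n) (simp_all add: field_simps)
  also have "(\<Sum>m<n. real (rebase (4 * q) q m)) = (\<Sum>m=1..n - 1. real (rebase (4 * q) q m))"
  proof (intro sum.mono_neutral_right ballI)
    fix m assume "m \<in> {..<n} - {1..n - 1}"
    then have "m = 0" by auto
    then show "real (rebase (4 * q) q m) = 0" by simp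
  qed (use assms(2) in auto)
  finally show ?thesis using digits by (simp add: q_def)
qed

theorem theorem3:
  fixes c :: "nat \<Rightarrow> nat \<Rightarrow> nat" and k :: "nat \<Rightarrow> nat" and n :: nat
  assumes "CARD('d::finite) \<ge> 3"
    and "\<And>m. m \<ge> 1 \<Longrightarrow> m = (\<Sum>i=0..k m. c m i * 2 ^ (CARD('d) * i))"
    and "\<And>m i. m \<ge> 1 \<Longrightarrow> i \<le> k m \<Longrightarrow> c m i \<le> 2 ^ CARD('d) - 1"
    and "\<And>m. m \<ge> 1 \<Longrightarrow> c m (k m) > 0"
    and "n \<ge> 2"
  shows "(\<exists>x :: nat \<Rightarrow> real ^ 'd. is_arg_min (energy n) (\<lambda>x. x \<in> configurations n) x) \<and>
    ground_state_energy TYPE('d) n =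
      (C_const CARD('d) + 2) * (real n - 1) * real n / 2
      - C_const CARD('d) *
          (\<Sum>m=1..n - 1. \<Sum>i=0..k m. real (c m i) * 2 ^ ((CARD('d) - 2) * i))"
proof -
  define L where "L = optimal_energy (2 ^ (CARD('d) - 2)) n"
  have d: "CARD('d) \<ge> 2" using assms(1) by simp
  obtain S :: "(real ^ 'd) set" where S: "finite S" "card S = n" "S \<subseteq> half_open_unit_cube"
    "\<forall>x\<in>S. off_grid x" "pair_energy S = L"
    using optimal_points_exist[OF d, of n] unfolding L_def by blast
  obtain x where x: "bij_betw x {..<n} S"
    using ex_bij_betw_nat_finite[OF S(1)] S(2) by (auto simp: atLeast0LessThan)
  have "x i \<in> S" if "i < n" for i using x that by (auto simp: bij_betw_def)
  then have conf: "x \<in> configurations n"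
    using x S(3,4) off_grid_not_frontier
    unfolding configurations_def bij_betw_def by blast
  have attained: "energy n x = L"
    using x S(5) by (simp add: energy_eq_pair_energy bij_betw_def)
  have lower: "L \<le> energy n y" if "y \<in> configurations n" for y :: "nat \<Rightarrow> real ^ 'd"
  proof -
    have inj: "inj_on y {..<n}" and "y ` {..<n} \<subseteq> half_open_unit_cube"
      using that by (auto simp: configurations_def)
    then show ?thesis
      using pair_energy_ge[OF d, of "y ` {..<n}"]
      by (simp add: L_def energy_eq_pair_energy card_image)
  qed
  have "is_arg_min (energy n) (\<lambda>x. x \<in> configurations n) x"
    using conf attained lower by (auto simp: is_arg_min_def not_less)
  moreover have "ground_state_energy TYPE('d) n = L"
    unfolding ground_state_energy_def using conf attained lower
    by (intro Least_equality) auto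
  moreover have "L = (C_const CARD('d) + 2) * (real n - 1) * real n / 2 - C_const CARD('d) *
      (\<Sum>m=1..n - 1. \<Sum>i=0..k m. real (c m i) * 2 ^ ((CARD('d) - 2) * i))"
    unfolding L_def using assms(5)
    by (intro optimal_energy_closed_form d assms(2,3)) simp_all
  ultimately show ?thesis by auto
qed

end
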